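(* Let $a,b\in\mathbb{R}\cup\{-\infty,+\infty\}$ with $a<b$, let $n\geqslant 2$ be an integer, and let $f:\left]a,b\right[^{n+2}\to\mathbb{R}$ be an integrable function. Then $$ \int_{\left]a,b\right[^n}f(\mathbf{x},\min x_i,\max x_i)\,d\mathbf{x} =\sum_{\substack{j,k=1\\ j\neq k}}^n\int_a^b dv\int_a^v du\int_{\left]u,v\right[^{n-2}} f(\mathbf{x},u,v\mid x_j=u,x_k=v)\prod_{i\in[n]\setminus\{j,k\}}dx_i . $$
   Context: $[n]:=\{1,\ldots,n\}$. For $\mathbf{x}=(x_1,\ldots,x_n)$, $\min x_i$ and $\max x_i$ denote $\min_{i\in[n]}x_i$ and $\max_{i\in[n]}x_i$. The notation $f(\mathbf{x},u,v\mid x_j=u,x_k=v)$ means the value of $f$ at the $(n+2)$-tuple whose first $n$ coordinates are those of $\mathbf{x}$ with the $j$th coordinate replaced by $u$ and the $k$th coordinate replaced by $v$, and whose last two coordinates are $u$ and $v$ (in this order). On the right-hand side the iterated integral is read as: integrate over the $n-2$ variables $x_i$ ($i\in[n]\setminus\{j,k\}$), each ranging over $\left]u,v\right[$, then over $u\in\left]a,v\right[$, then over $v\in\left]a,b\right[$. When $n=2$ the innermost integral is over no variables and is simply the value of the integrand. The sum is over ordered pairs $(j,k)$ with $j\neq k$.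
   Formalization: Added hypothesis: x ↦ f(x, min x_i, max x_i) is Lebesgue integrable on ]a,b[^n. Integrability of f on ]a,b[^{n+2} does not give this, since the points (x, min x_i, max x_i) form a null set there, so the left-hand integral could otherwise be undefined. *)

theory Defs
  imports "HOL-Analysis.Analysis"
begin

text \<open>A tuple indexed by \<open>I\<close> is a function \<open>nat \<Rightarrow> real\<close> that is \<open>undefined\<close> outside \<open>I\<close>.
  For \<open>I = {}\<close> there is exactly one such tuple and it has measure 1, so integrating over no
  variables yields the value of the integrand.  The product of Borel measures is completed so
  that integrability means Lebesgue (and not merely Borel) integrability.\<close>

definition lebesgue_PiM :: "nat set \<Rightarrow> (nat \<Rightarrow> real) measure" where
  "lebesgue_PiM I = completion (\<Pi>\<^sub>M i\<in>I. lborel)"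

definition open_box :: "nat set \<Rightarrow> ereal \<Rightarrow> ereal \<Rightarrow> (nat \<Rightarrow> real) set" where
  "open_box I a b = (\<Pi>\<^sub>E i\<in>I. einterval a b)"

text \<open>The tuple \<open>(x\<^sub>1, \<dots>, x\<^sub>n, u, v)\<close>.\<close>

definition append2 :: "nat \<Rightarrow> (nat \<Rightarrow> real) \<Rightarrow> real \<Rightarrow> real \<Rightarrow> (nat \<Rightarrow> real)" where
  "append2 n x u v = x(n + 1 := u, n + 2 := v)"

end

theory Submission
  imports Defs
begin

text \<open>Almost every point of the box has pairwise distinct coordinates, so up to a null set the box
  splits into the regions on which \<open>x\<^sub>j\<close> is the strict minimum and \<open>x\<^sub>k\<close> the strict maximum.  On
  such a region Fubini's theorem, applied to the coordinate \<open>k\<close> and then to the coordinate \<open>j\<close>,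
  gives the summand for \<open>(j, k)\<close>.\<close>

section \<open>Almost everywhere equality over a complete measure\<close>

context complete_measure
begin

text \<open>The preimages of a measurable set under \<open>f\<close> and \<open>g\<close> differ
  only inside a null set, and completeness makes every subset of a null set measurable.\<close>

lemma measurable_cong_AE_complete:
  assumes f: "f \<in> M \<rightarrow>\<^sub>M N" and ae: "AE x in M. f x = g x" and g: "g \<in> space M \<rightarrow> space N"
  shows "g \<in> M \<rightarrow>\<^sub>M N"
proof (rule measurableI)
  show "g x \<in> space N" if "x \<in> space M" for x
    using g that by auto
next
  fix A assume "A \<in> sets N"
  then have A: "f -` A \<inter> space M \<in> sets M"
    by (rule measurable_sets[OF f])
  have "AE x in M. x \<in> f -` A \<inter> space M \<longleftrightarrow> x \<in> g -` A \<inter> space M"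
    using ae by eventually_elim auto
  then show "g -` A \<inter> space M \<in> sets M"
    by (rule in_sets_AE[OF _ A]) auto
qed

lemma integrable_cong_AE_complete:
  fixes f g :: "'a \<Rightarrow> 'b :: {banach, second_countable_topology}"
  assumes "integrable M f" and ae: "AE x in M. f x = g x"
  shows "integrable M g"
proof -
  have "g \<in> borel_measurable M"
    using assms by (intro measurable_cong_AE_complete[OF _ ae]) auto
  then show ?thesis
    using assms(1) integrable_cong_AE[OF borel_measurable_integrable[OF assms(1)] _ ae] by simp
qed

text \<open>No measurability is needed: over a complete measure a function and its modifications on null
  sets are either all integrable or all assigned the junk value 0.\<close>

lemma integral_cong_AE_complete:
  fixes f g :: "'a \<Rightarrow> 'b :: {banach, second_countable_topology}"
  assumes ae: "AE x in M. f x = g x"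
  shows "integral\<^sup>L M f = integral\<^sup>L M g"
proof (cases "integrable M f")
  case True
  then show ?thesis
    using integrable_cong_AE_complete[OF True ae] by (intro integral_cong_AE[OF _ _ ae]) auto
next
  case False
  have "AE x in M. g x = f x"
    using ae by eventually_elim simp
  then have "\<not> integrable M g"
    using False integrable_cong_AE_complete by blast
  then show ?thesis
    using False by (simp add: not_integrable_integral_eq)
qed

end

section \<open>Fubini's theorem for finite products and their completions\<close>

context product_sigma_finite
begin

lemma measurable_fun_upd_pair:
  "(\<lambda>(y, x). x(i := y)) \<in> M i \<Otimes>\<^sub>M Pi\<^sub>M I M \<rightarrow>\<^sub>M Pi\<^sub>M (insert i I) M"
  using measurable_compose[OF measurable_pair_swap' measurable_add_dim[of i I M]]
  by (simp add: case_prod_unfold)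

text \<open>By Tonelli both measures give every measurable set the same mass. This transports facts
  about binary products to \<open>Pi\<^sub>M (insert i I) M\<close>; the new coordinate comes first
  in the pair, so its integral will be the outer one.\<close>

lemma distr_fun_upd:
  assumes "finite I" "i \<notin> I"
  shows "distr (M i \<Otimes>\<^sub>M Pi\<^sub>M I M) (Pi\<^sub>M (insert i I) M) (\<lambda>(y, x). x(i := y)) = Pi\<^sub>M (insert i I) M"
proof (rule measure_eqI)
  note [measurable] = measurable_fun_upd_pair[of i I]
  interpret P: sigma_finite_measure "Pi\<^sub>M I M"
    by (rule sigma_finite) fact
  let ?f = "\<lambda>(y, x). x(i := y)" and ?N = "Pi\<^sub>M (insert i I) M"
  fix A assume "A \<in> sets (distr (M i \<Otimes>\<^sub>M Pi\<^sub>M I M) ?N ?f)"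
  then have [measurable]: "A \<in> sets ?N"
    by simp
  have "emeasure (distr (M i \<Otimes>\<^sub>M Pi\<^sub>M I M) ?N ?f) A
      = (\<integral>\<^sup>+z. indicator A z \<partial>distr (M i \<Otimes>\<^sub>M Pi\<^sub>M I M) ?N ?f)"
    by simp
  also have "\<dots> = (\<integral>\<^sup>+z. indicator A (?f z) \<partial>(M i \<Otimes>\<^sub>M Pi\<^sub>M I M))"
    by (intro nn_integral_distr) simp_all
  also have "\<dots> = (\<integral>\<^sup>+y. \<integral>\<^sup>+x. indicator A (x(i := y)) \<partial>Pi\<^sub>M I M \<partial>M i)"
    by (subst P.nn_integral_fst[symmetric]) auto
  also have "\<dots> = emeasure ?N A"
    using assms by (subst product_nn_integral_insert_rev[symmetric]) auto
  finally show "emeasure (distr (M i \<Otimes>\<^sub>M Pi\<^sub>M I M) ?N ?f) A = emeasure ?N A" .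
qed simp

text \<open>Almost every section of a null set is null: the property is pulled back along the
  measure-preserving insertion map and then read off section by section.\<close>

lemma AE_PiM_insertD:
  assumes I: "finite I" "i \<notin> I" and ae: "AE x in Pi\<^sub>M (insert i I) M. P x"
  shows "AE y in M i. AE x in Pi\<^sub>M I M. P (x(i := y))"
proof -
  interpret P: sigma_finite_measure "Pi\<^sub>M I M"
    by (rule sigma_finite) fact
  interpret pair_sigma_finite "M i" "Pi\<^sub>M I M" ..
  have "AE z in M i \<Otimes>\<^sub>M Pi\<^sub>M I M. P (case z of (y, x) \<Rightarrow> x(i := y))"
    by (intro AE_distrD[OF measurable_fun_upd_pair]) (subst distr_fun_upd[OF I], rule ae)
  then show ?thesis
    by (auto dest!: AE_pair)
qed

lemma product_integral_insert_rev:
  fixes f :: "_ \<Rightarrow> _ :: {banach, second_countable_topology}"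
  assumes I: "finite I" "i \<notin> I" and f: "integrable (Pi\<^sub>M (insert i I) M) f"
  shows "AE y in M i. integrable (Pi\<^sub>M I M) (\<lambda>x. f (x(i := y)))"
    and "integrable (M i) (\<lambda>y. \<integral>x. f (x(i := y)) \<partial>Pi\<^sub>M I M)"
    and "integral\<^sup>L (Pi\<^sub>M (insert i I) M) f = (\<integral>y. \<integral>x. f (x(i := y)) \<partial>Pi\<^sub>M I M \<partial>M i)"
proof -
  interpret P: sigma_finite_measure "Pi\<^sub>M I M"
    by (rule sigma_finite) fact
  interpret pair_sigma_finite "M i" "Pi\<^sub>M I M" ..
  have int: "integrable (M i \<Otimes>\<^sub>M Pi\<^sub>M I M) (\<lambda>(y, x). f (x(i := y)))"
    using integrable_distr[OF measurable_fun_upd_pair, of i I f, unfolded distr_fun_upd[OF I], OF f]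
    by (simp add: case_prod_unfold)
  show "AE y in M i. integrable (Pi\<^sub>M I M) (\<lambda>x. f (x(i := y)))"
    and "integrable (M i) (\<lambda>y. \<integral>x. f (x(i := y)) \<partial>Pi\<^sub>M I M)"
    using AE_integrable_fst[OF int] integrable_fst[OF int] .
  have "integral\<^sup>L (Pi\<^sub>M (insert i I) M) f = (\<integral>(y, x). f (x(i := y)) \<partial>(M i \<Otimes>\<^sub>M Pi\<^sub>M I M))"
    using f
    by (subst distr_fun_upd[OF I, symmetric], subst integral_distr[OF measurable_fun_upd_pair])
      (auto simp: case_prod_unfold)
  also have "\<dots> = (\<integral>y. \<integral>x. f (x(i := y)) \<partial>Pi\<^sub>M I M \<partial>M i)"
    using integral_fst[OF int] by simp
  finally show "integral\<^sup>L (Pi\<^sub>M (insert i I) M) f = (\<integral>y. \<integral>x. f (x(i := y)) \<partial>Pi\<^sub>M I M \<partial>M i)" .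
qed

text \<open>Sections of a function measurable only for the completion can fail to be measurable. So
  \<open>g\<close> is replaced by an almost everywhere equal \<open>h\<close> that is measurable for
  the product itself, Fubini is applied to \<open>h\<close>, and the result is carried back to
  \<open>g\<close>.\<close>

lemma completion_integral_insert:
  fixes g :: "_ \<Rightarrow> real"
  assumes I: "finite I" "i \<notin> I" and g: "integrable (completion (Pi\<^sub>M (insert i I) M)) g"
  shows "AE y in M i. integrable (completion (Pi\<^sub>M I M)) (\<lambda>x. g (x(i := y)))"
    and "integral\<^sup>L (completion (Pi\<^sub>M (insert i I) M)) g
      = (\<integral>y. \<integral>x. g (x(i := y)) \<partial>completion (Pi\<^sub>M I M) \<partial>completion (M i))"
proof -
  let ?N = "Pi\<^sub>M (insert i I) M" and ?L = "Pi\<^sub>M I M"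
  obtain h where h[measurable]: "h \<in> borel_measurable ?N" and gh: "AE x in ?N. g x = h x"
    using completion_ex_borel_measurable_real[OF borel_measurable_integrable[OF g]] by auto
  have "integrable (completion ?N) h"
    using completion.integrable_cong_AE_complete[OF g] gh by (simp add: AE_completion_iff)
  then have int_h: "integrable ?N h"
    by (simp add: integrable_completion)
  note h_insert = product_integral_insert_rev[OF I int_h]
  \<comment> \<open>For almost every \<open>y\<close> the sections of \<open>g\<close> and
    \<open>h\<close> agree almost everywhere, so they have the same integral over the completed
    product.\<close>
  have sect: "AE y in M i. integrable (completion ?L) (\<lambda>x. g (x(i := y)))
      \<and> (\<integral>x. g (x(i := y)) \<partial>completion ?L) = (\<integral>x. h (x(i := y)) \<partial>?L)"
    using AE_PiM_insertD[OF I gh] h_insert(1)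
  proof eventually_elim
    fix y assume ae: "AE x in ?L. g (x(i := y)) = h (x(i := y))"
      and int: "integrable ?L (\<lambda>x. h (x(i := y)))"
    have m: "(\<lambda>x. h (x(i := y))) \<in> borel_measurable ?L"
      using int by (rule borel_measurable_integrable)
    have ae': "AE x in completion ?L. h (x(i := y)) = g (x(i := y))"
      using ae by (simp add: AE_completion_iff eq_commute)
    show "integrable (completion ?L) (\<lambda>x. g (x(i := y)))
      \<and> (\<integral>x. g (x(i := y)) \<partial>completion ?L) = (\<integral>x. h (x(i := y)) \<partial>?L)"
      using completion.integrable_cong_AE_complete[OF _ ae'] completion.integral_cong_AE_complete[OF ae'] int
      by (simp add: integrable_completion[OF m] integral_completion[OF m])
  qed
  then show "AE y in M i. integrable (completion ?L) (\<lambda>x. g (x(i := y)))"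
    by eventually_elim simp
  have "integral\<^sup>L (completion ?N) g = integral\<^sup>L (completion ?N) h"
    using gh by (intro completion.integral_cong_AE_complete) (simp add: AE_completion_iff)
  also have "\<dots> = (\<integral>y. \<integral>x. h (x(i := y)) \<partial>?L \<partial>M i)"
    by (simp add: integral_completion h_insert(3))
  \<comment> \<open>The inner integral of \<open>h\<close> is measurable for \<open>M i\<close>
    itself, so completing the outer measure does not change its integral.\<close>
  also have "\<dots> = (\<integral>y. \<integral>x. h (x(i := y)) \<partial>?L \<partial>completion (M i))"
    using h_insert(2) by (simp add: integral_completion borel_measurable_integrable)
  also have "\<dots> = (\<integral>y. \<integral>x. g (x(i := y)) \<partial>completion ?L \<partial>completion (M i))"
    using sect by (intro completion.integral_cong_AE_complete) (auto simp: AE_completion_iff)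
  finally show "integral\<^sup>L (completion ?N) g
      = (\<integral>y. \<integral>x. g (x(i := y)) \<partial>completion ?L \<partial>completion (M i))" .
qed

lemma completion_integral_insert2:
  fixes g :: "_ \<Rightarrow> real"
  assumes I: "finite I" "i \<notin> I" "j \<notin> I" "i \<noteq> j"
    and g: "integrable (completion (Pi\<^sub>M (insert i (insert j I)) M)) g"
  shows "integral\<^sup>L (completion (Pi\<^sub>M (insert i (insert j I)) M)) g
    = (\<integral>z. \<integral>y. \<integral>x. g (x(j := y, i := z)) \<partial>completion (Pi\<^sub>M I M)
        \<partial>completion (M j) \<partial>completion (M i))"
proof -
  \<comment> \<open>The section at \<open>z\<close> is integrable only for almost every
    \<open>z\<close>, so the inner application of Fubini holds only almost everywhere.\<close>
  have "AE z in M i. (\<integral>w. g (w(i := z)) \<partial>completion (Pi\<^sub>M (insert j I) M))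
      = (\<integral>y. \<integral>x. g (x(j := y, i := z)) \<partial>completion (Pi\<^sub>M I M) \<partial>completion (M j))"
    using completion_integral_insert(1)[OF _ _ g] I
    by (force elim: AE_mp intro: AE_I2 completion_integral_insert(2))
  then show ?thesis
    using I by (subst completion_integral_insert(2)[OF _ _ g])
      (auto intro!: completion.integral_cong_AE_complete simp: AE_completion_iff)
qed

end

section \<open>Coordinates are almost everywhere distinct\<close>

interpretation PiM_lborel: product_sigma_finite "\<lambda>_. lborel"
  by standard

lemma borel_measurable_PiM_component:
  "i \<in> I \<Longrightarrow> (\<lambda>x. x i) \<in> borel_measurable (\<Pi>\<^sub>M i\<in>I. (lborel :: real measure))"
  using measurable_component_singleton[of i I "\<lambda>_. lborel"] by simp

text \<open>With all coordinates except \<open>i\<close> fixed, the section of the diagonal lies in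
  the singleton \<open>{x j}\<close>, which is a null set; Tonelli then makes the whole diagonal
  null.\<close>

lemma AE_PiM_lborel_neq:
  assumes "finite I" "i \<in> I" "j \<in> I" "i \<noteq> j"
  shows "AE x in (\<Pi>\<^sub>M i\<in>I. (lborel :: real measure)). x i \<noteq> x j"
proof -
  define K where "K = I - {i}"
  have I: "I = insert i K" "finite K" "i \<notin> K" "j \<in> K"
    using assms by (auto simp: K_def)
  let ?N = "\<Pi>\<^sub>M i\<in>insert i K. (lborel :: real measure)"
  let ?E = "{x \<in> space ?N. x i = x j}"
  have [measurable]: "(\<lambda>x. x i) \<in> borel_measurable ?N" "(\<lambda>x. x j) \<in> borel_measurable ?N"
    using I by (auto intro!: borel_measurable_PiM_component)
  have E[measurable]: "?E \<in> sets ?N"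
    by measurable
  have "emeasure ?N ?E = (\<integral>\<^sup>+x. indicator ?E x \<partial>?N)"
    by simp
  also have "\<dots> = (\<integral>\<^sup>+x. \<integral>\<^sup>+y. indicator ?E (x(i := y)) \<partial>lborel \<partial>(\<Pi>\<^sub>M i\<in>K. lborel))"
    using I by (intro PiM_lborel.product_nn_integral_insert) auto
  also have "\<dots> = 0"
  proof -
    have "(\<integral>\<^sup>+y. indicator ?E (x(i := y)) \<partial>lborel) = 0" for x :: "'a \<Rightarrow> real"
    proof -
      have "(\<integral>\<^sup>+y. indicator ?E (x(i := y)) \<partial>lborel) \<le> (\<integral>\<^sup>+y. indicator {x j} y \<partial>lborel)"
        using assms(4) by (intro nn_integral_mono) (auto simp: indicator_def)
      then show ?thesis
        by simp
    qed
    then show ?thesis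
      by simp
  qed
  finally have "?E \<in> null_sets ?N"
    using E by auto
  then have "AE x in ?N. x \<notin> ?E"
    by (rule AE_not_in)
  then have "AE x in ?N. x i \<noteq> x j"
    using AE_space by eventually_elim auto
  then show ?thesis
    by (simp only: I(1)[symmetric])
qed

lemma AE_PiM_lborel_inj_on:
  assumes "finite I"
  shows "AE x in (\<Pi>\<^sub>M i\<in>I. (lborel :: real measure)). inj_on x I"
proof -
  have "AE x in (\<Pi>\<^sub>M i\<in>I. (lborel :: real measure)). \<forall>i\<in>I. \<forall>j\<in>I. i \<noteq> j \<longrightarrow> x i \<noteq> x j"
    using assms AE_PiM_lborel_neq[OF assms] by (intro AE_finite_allI) (auto intro!: AE_impI)
  then show ?thesis
    by eventually_elim (auto simp: inj_on_def)
qed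

section \<open>Regions with prescribed positions of minimum and maximum\<close>

text \<open>The clause \<open>x j < x k\<close> stands apart because the quantified part is vacuous
  when \<open>I = {j, k}\<close>. Strict inequalities keep the regions disjoint and match the open
  intervals of integration.\<close>

definition strict_extremes :: "'i set \<Rightarrow> 'i \<Rightarrow> 'i \<Rightarrow> ('i \<Rightarrow> 'a :: linorder) \<Rightarrow> bool" where
  "strict_extremes I j k x \<longleftrightarrow> x j < x k \<and> (\<forall>i\<in>I - {j, k}. x j < x i \<and> x i < x k)"

lemma strict_extremes_Min_Max:
  assumes "strict_extremes I j k x" "finite I" "j \<in> I" "k \<in> I"
  shows "Min (x ` I) = x j" and "Max (x ` I) = x k"
proof -
  have "x j \<le> x i \<and> x i \<le> x k" if "i \<in> I" for i
    using assms(1) that by (cases "i = j"; cases "i = k") (auto simp: strict_extremes_def less_imp_le)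
  then show "Min (x ` I) = x j" "Max (x ` I) = x k"
    using assms by (auto intro!: Min_eqI Max_eqI)
qed

text \<open>An injective tuple attains its minimum at a single index \<open>p\<close> and its
  maximum at a single index \<open>q\<close>, so it lies in exactly one region.\<close>

lemma strict_extremes_unique:
  assumes inj: "inj_on x I" and I: "finite I" "2 \<le> card I"
  obtains p q where "p \<in> I" "q \<in> I" "p \<noteq> q"
    and "\<And>j k. j \<in> I \<Longrightarrow> k \<in> I \<Longrightarrow> strict_extremes I j k x \<longleftrightarrow> j = p \<and> k = q"
proof -
  have ne: "I \<noteq> {}"
    using I by auto
  have "Min (x ` I) \<in> x ` I" "Max (x ` I) \<in> x ` I"
    using I ne by auto
  then obtain p q where pq: "p \<in> I" "q \<in> I" "x p = Min (x ` I)" "x q = Max (x ` I)"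
    by (metis imageE)
  have le: "x p \<le> x i" "x i \<le> x q" if "i \<in> I" for i
    using that I pq by auto
  have lt: "x p < x i" if "i \<in> I" "i \<noteq> p" for i
    using le that pq inj by (metis inj_on_def order_le_less)
  have gt: "x i < x q" if "i \<in> I" "i \<noteq> q" for i
    using le that pq inj by (metis inj_on_def order_le_less)
  have neq: "p \<noteq> q"
  proof
    assume "p = q"
    \<comment> \<open>If minimum and maximum shared an index, the tuple would be constant, and
      injectivity would leave only one index.\<close>
    then have "x i = x p" if "i \<in> I" for i
      using le[OF that] by (simp add: order.antisym)
    then have "I \<subseteq> {p}"
      using inj pq by (auto simp: inj_on_def)
    then have "card I \<le> card {p}"
      by (intro card_mono) auto
    then show False
      using I by simp
  qed
  have iff: "strict_extremes I j k x \<longleftrightarrow> j = p \<and> k = q" if "j \<in> I" "k \<in> I" for j k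
  proof
    assume "strict_extremes I j k x"
    from strict_extremes_Min_Max[OF this I(1) that] show "j = p \<and> k = q"
      using that pq inj by (auto simp: inj_on_def)
  next
    assume "j = p \<and> k = q"
    then show "strict_extremes I j k x"
      using lt gt lt[OF pq(2)] neq by (auto simp: strict_extremes_def)
  qed
  show ?thesis
    by (rule that[OF pq(1,2) neq iff])
qed

lemma measurable_strict_extremes:
  assumes "finite I" "j \<in> I" "k \<in> I"
  shows "Measurable.pred (\<Pi>\<^sub>M i\<in>I. (lborel :: real measure)) (strict_extremes I j k)"
  unfolding strict_extremes_def[abs_def] using assms
  by (auto intro!: pred_intros_logic pred_intros_finite borel_measurable_pred_less
      borel_measurable_PiM_component)

text \<open>This turns a region into iterated ranges of integration. Since the remaining coordinates
  lie between \<open>u\<close> and \<open>v\<close>, the bounds \<open>a\<close> and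
  \<open>b\<close> constrain only \<open>u\<close> and \<open>v\<close>. Extensionality of
  \<open>x\<close> takes care of the values outside \<open>I\<close>.\<close>

lemma fun_upd2_in_open_box_iff:
  assumes x: "x \<in> extensional (I - {j, k})" and jk: "j \<in> I" "k \<in> I" "j \<noteq> k"
  shows "x(j := u, k := v) \<in> open_box I a b \<and> strict_extremes I j k (x(j := u, k := v))
    \<longleftrightarrow> v \<in> einterval a b \<and> u \<in> einterval a v \<and> x \<in> open_box (I - {j, k}) u v"
proof -
  have "a < ereal w" if "a < ereal u" "u < w" for w
    using that by (metis ereal_less(1) less_ereal.simps(1) less_trans)
  moreover have "ereal w < b" if "ereal v < b" "w < v" for w
    using that by (metis less_ereal.simps(1) less_trans)
  ultimately show ?thesis
    using jk x
    by (auto simp: open_box_def strict_extremes_def einterval_def PiE_iff extensional_def)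
qed

section \<open>Summing the integrals over the regions\<close>

theorem theorem3:
  fixes a b :: ereal and n :: nat and f :: "(nat \<Rightarrow> real) \<Rightarrow> real"
  assumes "a < b"
    and "n \<ge> 2"
    and f_integrable: "set_integrable (lebesgue_PiM {1..n + 2}) (open_box {1..n + 2} a b) f"
    and lhs_integrable: "set_integrable (lebesgue_PiM {1..n}) (open_box {1..n} a b)
      (\<lambda>x. f (append2 n x (Min (x ` {1..n})) (Max (x ` {1..n}))))"
  shows "(LINT x:open_box {1..n} a b|lebesgue_PiM {1..n}.
            f (append2 n x (Min (x ` {1..n})) (Max (x ` {1..n}))))
       = (\<Sum>(j, k) \<in> {(j, k). j \<in> {1..n} \<and> k \<in> {1..n} \<and> j \<noteq> k}.
            LINT v=a..b|lebesgue. (LINT u=a..ereal v|lebesgue.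
              (LINT x:open_box ({1..n} - {j, k}) (ereal u) (ereal v)|lebesgue_PiM ({1..n} - {j, k}).
                f (append2 n (x(j := u, k := v)) u v))))"
proof -
  define I where "I = {1..n}"
  let ?L = "lebesgue_PiM I" and ?B = "open_box I a b"
  let ?S = "{(j, k). j \<in> I \<and> k \<in> I \<and> j \<noteq> k}"
  have I: "finite I" "2 \<le> card I"
    using assms(2) by (auto simp: I_def)
  have fin_S: "finite ?S"
    by (rule finite_subset[of _ "I \<times> I"]) (use I in auto)
  \<comment> \<open>The indicator of the box goes into the integrand, so that every integral runs
    over the full space; \<open>G j k\<close> is \<open>g\<close> cut down to one region.\<close>
  define g where "g = (\<lambda>x. indicator ?B x * f (append2 n x (Min (x ` I)) (Max (x ` I))))"
  define G where "G j k x = (if strict_extremes I j k x then g x else 0)" for j k x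
  have int_g: "integrable ?L g"
    using lhs_integrable by (simp add: set_integrable_def g_def I_def)
  have int_G: "integrable ?L (G j k)" if "j \<in> I" "k \<in> I" for j k
  proof -
    have [measurable]: "Measurable.pred ?L (strict_extremes I j k)"
      unfolding lebesgue_PiM_def
      by (intro measurable_completion measurable_strict_extremes I that)
    \<comment> \<open>\<open>G j k\<close> is measurable because its region is, and it is dominated
      by \<open>g\<close>.\<close>
    show ?thesis
      using int_g by (rule Bochner_Integration.integrable_bound) (use int_g in \<open>auto simp: G_def[abs_def]\<close>)
  qed
  have "AE x in ?L. inj_on x I"
    unfolding lebesgue_PiM_def by (intro AE_completion AE_PiM_lborel_inj_on I)
  then have split: "AE x in ?L. g x = (\<Sum>(j, k)\<in>?S. G j k x)"
  proof eventually_elim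
    fix x :: "nat \<Rightarrow> real" assume "inj_on x I"
    then obtain p q where pq: "p \<in> I" "q \<in> I" "p \<noteq> q"
      "\<And>j k. j \<in> I \<Longrightarrow> k \<in> I \<Longrightarrow> strict_extremes I j k x \<longleftrightarrow> j = p \<and> k = q"
      by (rule strict_extremes_unique[OF _ I]) blast
    \<comment> \<open>Only the pair \<open>(p, q)\<close> of the positions of minimum and maximum
      contributes to the sum.\<close>
    have "(\<Sum>(j, k)\<in>?S. G j k x) = (\<Sum>s\<in>?S. if s = (p, q) then g x else 0)"
      using pq by (intro sum.cong) (auto simp: G_def split: if_split_asm)
    also have "\<dots> = g x"
      using fin_S pq by simp
    finally show "g x = (\<Sum>(j, k)\<in>?S. G j k x)" ..
  qed
  have summand: "integral\<^sup>L ?L (G j k) = (LINT v=a..b|lebesgue. (LINT u=a..ereal v|lebesgue.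
      (LINT x:open_box (I - {j, k}) (ereal u) (ereal v)|lebesgue_PiM (I - {j, k}).
        f (append2 n (x(j := u, k := v)) u v))))"
    if jk: "j \<in> I" "k \<in> I" "j \<noteq> k" for j k
  proof -
    let ?J = "I - {j, k}"
    \<comment> \<open>Coordinate \<open>k\<close> is split off first, which makes \<open>v\<close>
      the outermost variable and \<open>u\<close> the next one.\<close>
    have I_eq: "I = insert k (insert j ?J)"
      using jk by auto
    \<comment> \<open>On the region the minimum is \<open>u\<close> and the maximum is
      \<open>v\<close>; off it both sides vanish. The nested indicators can then be pulled out of
      the integrals one at a time.\<close>
    have G_eq: "G j k (x(j := u, k := v)) = indicator (einterval a b) v *
        (indicator (einterval a (ereal v)) u * (indicator (open_box ?J u v) x *
          f (append2 n (x(j := u, k := v)) u v)))"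
      if "x \<in> space (lebesgue_PiM ?J)" for x u v
    proof -
      let ?x = "x(j := u, k := v)"
      have "x \<in> extensional ?J"
        using that by (simp add: lebesgue_PiM_def space_PiM PiE_iff)
      note iff = fun_upd2_in_open_box_iff[OF this jk, of u v a b]
      show ?thesis
      proof (cases "?x \<in> ?B \<and> strict_extremes I j k ?x")
        case True
        have "Min (?x ` I) = u" "Max (?x ` I) = v"
          using strict_extremes_Min_Max[of I j k ?x] True I jk by simp_all
        with True iff show ?thesis
          by (simp add: G_def g_def)
      next
        case False
        with iff show ?thesis
          by (auto simp: G_def g_def indicator_def)
      qed
    qed
    have "integral\<^sup>L ?L (G j k) = (\<integral>v. \<integral>u. \<integral>x. G j k (x(j := u, k := v))
        \<partial>lebesgue_PiM ?J \<partial>lebesgue \<partial>lebesgue)"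
      using PiM_lborel.completion_integral_insert2[of ?J k j "G j k"] int_G[OF jk(1,2)] I jk I_eq
      by (simp add: lebesgue_PiM_def)
    also have "\<dots> = (\<integral>v. indicator (einterval a b) v * (\<integral>u. indicator (einterval a (ereal v)) u *
        (\<integral>x. indicator (open_box ?J u v) x * f (append2 n (x(j := u, k := v)) u v)
          \<partial>lebesgue_PiM ?J) \<partial>lebesgue) \<partial>lebesgue)"
      by (simp add: G_eq cong: Bochner_Integration.integral_cong)
    also have "\<dots> = (LINT v=a..b|lebesgue. (LINT u=a..ereal v|lebesgue.
        (LINT x:open_box ?J (ereal u) (ereal v)|lebesgue_PiM ?J.
          f (append2 n (x(j := u, k := v)) u v))))"
      \<comment> \<open>An interval integral changes sign when its bounds are reversed. For the
        outer one \<open>a < b\<close> rules this out; the inner one could be reversed only for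
        \<open>v < a\<close>, where the outer indicator is 0.\<close>
      unfolding interval_lebesgue_integral_def set_lebesgue_integral_def using assms(1)
      by (auto intro!: Bochner_Integration.integral_cong simp: indicator_def einterval_def)
    finally show ?thesis .
  qed
  have "(LINT x:?B|?L. f (append2 n x (Min (x ` I)) (Max (x ` I)))) = integral\<^sup>L ?L g"
    by (simp add: set_lebesgue_integral_def g_def)
  also have "\<dots> = (\<integral>x. (\<Sum>(j, k)\<in>?S. G j k x) \<partial>?L)"
    using split unfolding lebesgue_PiM_def by (rule completion.integral_cong_AE_complete)
  \<comment> \<open>Linearity applies because each \<open>G j k\<close> is integrable on its
    own.\<close>
  also have "\<dots> = (\<Sum>(j, k)\<in>?S. integral\<^sup>L ?L (G j k))"
    unfolding case_prod_unfold
    by (intro Bochner_Integration.integral_sum) (auto intro: int_G)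
  also have "\<dots> = (\<Sum>(j, k)\<in>?S. LINT v=a..b|lebesgue. (LINT u=a..ereal v|lebesgue.
      (LINT x:open_box (I - {j, k}) (ereal u) (ereal v)|lebesgue_PiM (I - {j, k}).
        f (append2 n (x(j := u, k := v)) u v))))"
    by (intro sum.cong) (auto simp: summand)
  finally show ?thesis
    unfolding I_def .
qed

end
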